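(* Let $\{(Q_i,*_i)\}_{i\in\Lambda}$ be a family of quandles. If every $Q_i$ is right-orderable, then the product quandle $\prod_{i\in\Lambda}Q_i$ is right-orderable. Similarly, if every $Q_i$ is bi-orderable, then $\prod_{i\in\Lambda}Q_i$ is bi-orderable.
   Context: A quandle is a non-empty set $Q$ with a binary operation $*$ such that $x*x=x$; for all $x,y$ there is a unique $z$ with $x=z*y$; and $(x*y)*z=(x*z)*(y*z)$. The product quandle is the cartesian product $\prod_{i\in\Lambda}Q_i$ with the operation $(x_i)\star(y_i)=(x_i*_iy_i)$. A quandle $Q$ is right-orderable if it has a (strict) linear order $<$ such that $x<y$ implies $x*z<y*z$ for all $x,y,z$; it is bi-orderable if it has a linear order $<$ such that $x<y$ implies both $x*z<y*z$ and $z*x<z*y$ for all $x,y,z$. The axiom of choice is assumed. *)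

theory Defs
  imports Main "HOL-Library.FuncSet"
begin

locale quandle =
  fixes Q :: "'a set" and qop :: "'a \<Rightarrow> 'a \<Rightarrow> 'a"
  assumes nonempty: "Q \<noteq> {}"
    and closed: "\<lbrakk>x \<in> Q; y \<in> Q\<rbrakk> \<Longrightarrow> qop x y \<in> Q"
    and idem: "x \<in> Q \<Longrightarrow> qop x x = x"
    and right_div: "\<lbrakk>x \<in> Q; y \<in> Q\<rbrakk> \<Longrightarrow> \<exists>!z. z \<in> Q \<and> x = qop z y"
    and self_distrib: "\<lbrakk>x \<in> Q; y \<in> Q; z \<in> Q\<rbrakk> \<Longrightarrow> qop (qop x y) z = qop (qop x z) (qop y z)"

text \<open>A pair (x, y) in r stands for x < y.  The constant
  \<^const>\<open>strict_linear_order_on\<close> requires transitivity and irreflexivity of the whole relation,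
  so the order is taken to be a relation on the carrier only.\<close>

definition right_orderable :: "'a set \<Rightarrow> ('a \<Rightarrow> 'a \<Rightarrow> 'a) \<Rightarrow> bool" where
  "right_orderable Q qop \<longleftrightarrow>
     (\<exists>r. r \<subseteq> Q \<times> Q \<and> strict_linear_order_on Q r \<and>
       (\<forall>x\<in>Q. \<forall>y\<in>Q. \<forall>z\<in>Q. (x, y) \<in> r \<longrightarrow> (qop x z, qop y z) \<in> r))"

definition bi_orderable :: "'a set \<Rightarrow> ('a \<Rightarrow> 'a \<Rightarrow> 'a) \<Rightarrow> bool" where
  "bi_orderable Q qop \<longleftrightarrow>
     (\<exists>r. r \<subseteq> Q \<times> Q \<and> strict_linear_order_on Q r \<and>
       (\<forall>x\<in>Q. \<forall>y\<in>Q. \<forall>z\<in>Q. (x, y) \<in> r \<longrightarrow>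
          (qop x z, qop y z) \<in> r \<and> (qop z x, qop z y) \<in> r))"

text \<open>The product of the carriers is the extensional product
  \<^term>\<open>Pi\<^sub>E I Q\<close>; hence the componentwise operation is restricted to the index set.\<close>

definition prod_op :: "'i set \<Rightarrow> ('i \<Rightarrow> 'a \<Rightarrow> 'a \<Rightarrow> 'a) \<Rightarrow> ('i \<Rightarrow> 'a) \<Rightarrow> ('i \<Rightarrow> 'a) \<Rightarrow> ('i \<Rightarrow> 'a)" where
  "prod_op I qop x y = (\<lambda>i\<in>I. qop i (x i) (y i))"

lemma quandle_prod:
  assumes "\<And>i. i \<in> I \<Longrightarrow> quandle (Q i) (qop i)"
  shows "quandle (Pi\<^sub>E I Q) (prod_op I qop)"
proof
  show "Pi\<^sub>E I Q \<noteq> {}"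
    using quandle.nonempty[OF assms] by (simp add: PiE_eq_empty_iff)
next
  fix x y assume "x \<in> Pi\<^sub>E I Q" "y \<in> Pi\<^sub>E I Q"
  then show "prod_op I qop x y \<in> Pi\<^sub>E I Q"
    using quandle.closed[OF assms] by (auto simp: prod_op_def PiE_iff)
next
  fix x assume "x \<in> Pi\<^sub>E I Q"
  then show "prod_op I qop x x = x"
    using quandle.idem[OF assms]
    by (intro ext) (auto simp: prod_op_def restrict_def PiE_iff extensional_def)
next
  fix x y assume x: "x \<in> Pi\<^sub>E I Q" and y: "y \<in> Pi\<^sub>E I Q"
  have ex1: "\<exists>!z. z \<in> Q i \<and> x i = qop i z (y i)" if "i \<in> I" for i
    using quandle.right_div[OF assms[OF that]] x y that by blast
  define z where "z = (\<lambda>i\<in>I. THE z. z \<in> Q i \<and> x i = qop i z (y i))"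
  have z: "z i \<in> Q i \<and> x i = qop i (z i) (y i)" if "i \<in> I" for i
    using theI'[OF ex1[OF that]] that by (simp add: z_def)
  show "\<exists>!z. z \<in> Pi\<^sub>E I Q \<and> x = prod_op I qop z y"
  proof (intro ex1I conjI)
    show "z \<in> Pi\<^sub>E I Q"
      using z by (auto simp: PiE_iff z_def)
    show "x = prod_op I qop z y"
      using z x by (intro ext) (auto simp: prod_op_def restrict_def PiE_iff extensional_def)
  next
    fix w assume w: "w \<in> Pi\<^sub>E I Q \<and> x = prod_op I qop w y"
    have "w i = z i" if "i \<in> I" for i
    proof -
      have "x i = prod_op I qop w y i" using w by blast
      then have "x i = qop i (w i) (y i)" using that by (simp add: prod_op_def)
      moreover have "w i \<in> Q i" using w that by blast
      ultimately show ?thesis using ex1[OF that] z[OF that] by blast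
    qed
    moreover have "w \<in> extensional I" "z \<in> extensional I"
      using w by (auto simp: PiE_iff z_def)
    ultimately show "w = z" by (meson extensionalityI)
  qed
next
  fix x y z assume "x \<in> Pi\<^sub>E I Q" "y \<in> Pi\<^sub>E I Q" "z \<in> Pi\<^sub>E I Q"
  then show "prod_op I qop (prod_op I qop x y) z
      = prod_op I qop (prod_op I qop x z) (prod_op I qop y z)"
    using quandle.self_distrib[OF assms]
    by (intro ext) (auto simp: prod_op_def restrict_def PiE_iff)
qed

end

theory Submission
  imports Defs
begin

text \<open>Well-order the index set and order the product lexicographically: two distinct families
  are compared at the first index where they differ. A componentwise operation that is strictly
  increasing in each component keeps the agreement below that index and the inequality at it.\<close>

text \<open>\<open>W\<close> is meant as a strict well-order of the indices. When each
  \<open>r i\<close> is irreflexive, the index \<open>i\<close> in the body is then the first one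
  where \<open>x\<close> and \<open>y\<close> differ. Both families are confined to the product
  because orderability asks for a relation on the carrier.\<close>

definition lex_prod_on ::
    "'i rel \<Rightarrow> 'i set \<Rightarrow> ('i \<Rightarrow> 'a set) \<Rightarrow> ('i \<Rightarrow> 'a rel) \<Rightarrow> ('i \<Rightarrow> 'a) rel" where
  "lex_prod_on W I Q r = {(x, y). x \<in> Pi\<^sub>E I Q \<and> y \<in> Pi\<^sub>E I Q \<and>
     (\<exists>i\<in>I. (x i, y i) \<in> r i \<and> (\<forall>j\<in>I. (j, i) \<in> W \<longrightarrow> x j = y j))}"

lemma lex_prod_onI:
  assumes "x \<in> Pi\<^sub>E I Q" "y \<in> Pi\<^sub>E I Q" "i \<in> I" "(x i, y i) \<in> r i"
    and "\<And>j. \<lbrakk>j \<in> I; (j, i) \<in> W\<rbrakk> \<Longrightarrow> x j = y j"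
  shows "(x, y) \<in> lex_prod_on W I Q r"
  using assms by (auto simp: lex_prod_on_def)

lemma lex_prod_onE:
  assumes "(x, y) \<in> lex_prod_on W I Q r"
  obtains i where "x \<in> Pi\<^sub>E I Q" "y \<in> Pi\<^sub>E I Q" "i \<in> I" "(x i, y i) \<in> r i"
    and "\<And>j. \<lbrakk>j \<in> I; (j, i) \<in> W\<rbrakk> \<Longrightarrow> x j = y j"
  using assms by (auto simp: lex_prod_on_def)

lemma lex_prod_on_subset: "lex_prod_on W I Q r \<subseteq> Pi\<^sub>E I Q \<times> Pi\<^sub>E I Q"
  by (auto simp: lex_prod_on_def)

text \<open>Irreflexivity is inherited from the components, totality comes from well-foundedness of
  \<open>W\<close>, and transitivity rests on \<open>W\<close> being transitive and total on
  \<open>I\<close>.\<close>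

lemma strict_linear_order_on_lex_prod_on:
  assumes W: "wf W" "trans W" "total_on I W"
    and r: "\<And>i. i \<in> I \<Longrightarrow> strict_linear_order_on (Q i) (r i)"
  shows "strict_linear_order_on (Pi\<^sub>E I Q) (lex_prod_on W I Q r)"
proof -
  have tr: "trans (r i)" and irr: "irrefl (r i)" and tot: "total_on (Q i) (r i)" if "i \<in> I" for i
    using r[OF that] by (auto simp: strict_linear_order_on_def)
  have "trans (lex_prod_on W I Q r)"
  proof (rule transI)
    fix x y z
    assume xy: "(x, y) \<in> lex_prod_on W I Q r" and yz: "(y, z) \<in> lex_prod_on W I Q r"
    then have xz: "x \<in> Pi\<^sub>E I Q" "z \<in> Pi\<^sub>E I Q"
      by (auto simp: lex_prod_on_def)
    obtain i where i: "i \<in> I" "(x i, y i) \<in> r i" "\<And>j. \<lbrakk>j \<in> I; (j, i) \<in> W\<rbrakk> \<Longrightarrow> x j = y j"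
      using xy by (auto simp: lex_prod_on_def)
    obtain k where k: "k \<in> I" "(y k, z k) \<in> r k" "\<And>j. \<lbrakk>j \<in> I; (j, k) \<in> W\<rbrakk> \<Longrightarrow> y j = z j"
      using yz by (auto simp: lex_prod_on_def)
    \<comment> \<open>The smaller of \<open>i\<close> and \<open>k\<close> decides the comparison of
      \<open>x\<close> with \<open>z\<close>: below it all three families agree. At it either both
      inequalities hold and compose, or one inequality meets an equality.\<close>
    consider "i = k" | "(i, k) \<in> W" | "(k, i) \<in> W"
      using W(3) i(1) k(1) by (auto simp: total_on_def)
    then show "(x, z) \<in> lex_prod_on W I Q r"
    proof cases
      case 1
      then show ?thesis
        using xz i k transD[OF tr[OF i(1)]] by (intro lex_prod_onI[where i = i]) auto
    next
      case 2
      then show ?thesis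
        using xz i k transD[OF W(2)] by (intro lex_prod_onI[where i = i]) metis+
    next
      case 3
      then show ?thesis
        using xz i k transD[OF W(2)] by (intro lex_prod_onI[where i = k]) metis+
    qed
  qed
  moreover have "irrefl (lex_prod_on W I Q r)"
    using irr by (auto simp: irrefl_def lex_prod_on_def)
  moreover have "total_on (Pi\<^sub>E I Q) (lex_prod_on W I Q r)"
  proof (rule total_onI)
    fix x y assume xy: "x \<in> Pi\<^sub>E I Q" "y \<in> Pi\<^sub>E I Q" "x \<noteq> y"
    \<comment> \<open>Members of the extensional product agree outside \<open>I\<close>, so distinct
      ones must differ at an index in \<open>I\<close>; well-foundedness then supplies a minimal
      such index.\<close>
    then have "{i \<in> I. x i \<noteq> y i} \<noteq> {}"
      using PiE_ext[OF xy(1,2)] by auto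
    then obtain i where "i \<in> {i \<in> I. x i \<noteq> y i}"
        "\<And>j. (j, i) \<in> W \<Longrightarrow> j \<notin> {i \<in> I. x i \<noteq> y i}"
      by (rule wfE_min'[OF W(1)]) blast
    then have i: "i \<in> I" "x i \<noteq> y i" and min: "\<And>j. \<lbrakk>j \<in> I; (j, i) \<in> W\<rbrakk> \<Longrightarrow> x j = y j"
      by auto
    have "(x i, y i) \<in> r i \<or> (y i, x i) \<in> r i"
      using tot[OF i(1)] i xy by (auto simp: total_on_def PiE_iff)
    then show "(x, y) \<in> lex_prod_on W I Q r \<or> (y, x) \<in> lex_prod_on W I Q r"
      using xy i min by (auto simp: lex_prod_on_def)
  qed
  ultimately show ?thesis
    by (simp add: strict_linear_order_on_def)
qed

text \<open>Stated for an arbitrary family of self-maps \<open>f i\<close>, so that left and right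
  translations of the product quandle are both instances.\<close>

lemma lex_prod_on_mono:
  assumes "(x, y) \<in> lex_prod_on W I Q r"
    and "\<And>i a. \<lbrakk>i \<in> I; a \<in> Q i\<rbrakk> \<Longrightarrow> f i a \<in> Q i"
    and "\<And>i a b. \<lbrakk>i \<in> I; a \<in> Q i; b \<in> Q i; (a, b) \<in> r i\<rbrakk> \<Longrightarrow> (f i a, f i b) \<in> r i"
  shows "((\<lambda>i\<in>I. f i (x i)), (\<lambda>i\<in>I. f i (y i))) \<in> lex_prod_on W I Q r"
  using assms(1)
proof (rule lex_prod_onE)
  fix i
  assume *: "x \<in> Pi\<^sub>E I Q" "y \<in> Pi\<^sub>E I Q" "i \<in> I" "(x i, y i) \<in> r i"
    "\<And>j. \<lbrakk>j \<in> I; (j, i) \<in> W\<rbrakk> \<Longrightarrow> x j = y j"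
  show ?thesis
    by (rule lex_prod_onI[where i = i]) (use * assms(2,3) in \<open>auto simp: PiE_iff\<close>)
qed

text \<open>Here \<open>left\<close> refers to the argument that varies: the map is right
  translation by \<open>z\<close>, which acts on component \<open>i\<close> as right translation by
  \<open>z i\<close>. Closure of the quandle operation keeps it inside \<open>Q i\<close>.\<close>

lemma prod_op_left_mono_lex:
  assumes "\<And>i. i \<in> I \<Longrightarrow> quandle (Q i) (qop i)"
    and "\<And>i a b c. \<lbrakk>i \<in> I; a \<in> Q i; b \<in> Q i; c \<in> Q i; (a, b) \<in> r i\<rbrakk>
          \<Longrightarrow> (qop i a c, qop i b c) \<in> r i"
    and "(x, y) \<in> lex_prod_on W I Q r" "z \<in> Pi\<^sub>E I Q"
  shows "(prod_op I qop x z, prod_op I qop y z) \<in> lex_prod_on W I Q r"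
  unfolding prod_op_def
  by (rule lex_prod_on_mono[where f = "\<lambda>i a. qop i a (z i)"])
    (use assms quandle.closed[OF assms(1)] in \<open>auto simp: PiE_iff\<close>)

lemma prod_op_right_mono_lex:
  assumes "\<And>i. i \<in> I \<Longrightarrow> quandle (Q i) (qop i)"
    and "\<And>i a b c. \<lbrakk>i \<in> I; a \<in> Q i; b \<in> Q i; c \<in> Q i; (a, b) \<in> r i\<rbrakk>
          \<Longrightarrow> (qop i c a, qop i c b) \<in> r i"
    and "(x, y) \<in> lex_prod_on W I Q r" "z \<in> Pi\<^sub>E I Q"
  shows "(prod_op I qop z x, prod_op I qop z y) \<in> lex_prod_on W I Q r"
  unfolding prod_op_def
  \<comment> \<open>The component maps are now the left translations by \<open>z i\<close>.\<close>
  by (rule lex_prod_on_mono[where f = "\<lambda>i. qop i (z i)"])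
    (use assms quandle.closed[OF assms(1)] in \<open>auto simp: PiE_iff\<close>)

text \<open>By Zermelo's theorem the whole index type has a well-order \<open>R\<close>; its strict
  part \<open>R - Id\<close> is well-founded by definition, and totality passes to the subset
  \<open>I\<close>.\<close>

lemma ex_strict_well_order_on:
  obtains W :: "'i rel" where "wf W" "trans W" "total_on I W"
proof -
  obtain R :: "'i rel" where R: "well_order_on UNIV R"
    using well_order_on by blast
  show thesis
  proof
    show "wf (R - Id)"
      using R by (simp add: well_order_on_def)
    \<comment> \<open>Antisymmetry of \<open>R\<close> is what preserves transitivity when the
      diagonal is removed.\<close>
    show "trans (R - Id)"
      using R by (auto simp: order_on_defs intro: trans_diff_Id)
    show "total_on I (R - Id)"
      using R by (auto simp: order_on_defs total_on_def)
  qed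
qed

theorem proposition4p4:
  fixes I :: "'i set" and Q :: "'i \<Rightarrow> 'a set" and qop :: "'i \<Rightarrow> 'a \<Rightarrow> 'a \<Rightarrow> 'a"
  assumes "\<And>i. i \<in> I \<Longrightarrow> quandle (Q i) (qop i)"
  shows "((\<forall>i\<in>I. right_orderable (Q i) (qop i)) \<longrightarrow> right_orderable (Pi\<^sub>E I Q) (prod_op I qop)) \<and>
         ((\<forall>i\<in>I. bi_orderable (Q i) (qop i)) \<longrightarrow> bi_orderable (Pi\<^sub>E I Q) (prod_op I qop))"
proof (intro conjI impI)
  obtain W :: "'i rel" where W: "wf W" "trans W" "total_on I W"
    by (rule ex_strict_well_order_on)
  {
    assume "\<forall>i\<in>I. right_orderable (Q i) (qop i)"
    \<comment> \<open>The axiom of choice enters again, to select one compatible order on every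
      component simultaneously.\<close>
    then obtain r where r: "\<forall>i\<in>I. r i \<subseteq> Q i \<times> Q i \<and> strict_linear_order_on (Q i) (r i) \<and>
        (\<forall>x\<in>Q i. \<forall>y\<in>Q i. \<forall>z\<in>Q i. (x, y) \<in> r i \<longrightarrow> (qop i x z, qop i y z) \<in> r i)"
      unfolding right_orderable_def by (rule bchoice[THEN exE])
    have lin: "\<And>i. i \<in> I \<Longrightarrow> strict_linear_order_on (Q i) (r i)"
      and left: "\<And>i a b c. \<lbrakk>i \<in> I; a \<in> Q i; b \<in> Q i; c \<in> Q i; (a, b) \<in> r i\<rbrakk>
          \<Longrightarrow> (qop i a c, qop i b c) \<in> r i"
      using r by blast+
    show "right_orderable (Pi\<^sub>E I Q) (prod_op I qop)"
      unfolding right_orderable_def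
    proof (intro exI[of _ "lex_prod_on W I Q r"] conjI ballI impI)
      show "lex_prod_on W I Q r \<subseteq> Pi\<^sub>E I Q \<times> Pi\<^sub>E I Q"
        by (rule lex_prod_on_subset)
      show "strict_linear_order_on (Pi\<^sub>E I Q) (lex_prod_on W I Q r)"
        using W lin by (rule strict_linear_order_on_lex_prod_on)
    qed (rule prod_op_left_mono_lex[OF assms left])
  next
    assume "\<forall>i\<in>I. bi_orderable (Q i) (qop i)"
    then obtain r where r: "\<forall>i\<in>I. r i \<subseteq> Q i \<times> Q i \<and> strict_linear_order_on (Q i) (r i) \<and>
        (\<forall>x\<in>Q i. \<forall>y\<in>Q i. \<forall>z\<in>Q i. (x, y) \<in> r i \<longrightarrow> 
          (qop i x z, qop i y z) \<in> r i \<and> (qop i z x, qop i z y) \<in> r i)"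
      unfolding bi_orderable_def by (rule bchoice[THEN exE])
    have lin: "\<And>i. i \<in> I \<Longrightarrow> strict_linear_order_on (Q i) (r i)"
      and left: "\<And>i a b c. \<lbrakk>i \<in> I; a \<in> Q i; b \<in> Q i; c \<in> Q i; (a, b) \<in> r i\<rbrakk>
          \<Longrightarrow> (qop i a c, qop i b c) \<in> r i"
      and right: "\<And>i a b c. \<lbrakk>i \<in> I; a \<in> Q i; b \<in> Q i; c \<in> Q i; (a, b) \<in> r i\<rbrakk>
          \<Longrightarrow> (qop i c a, qop i c b) \<in> r i"
      using r by blast+
    show "bi_orderable (Pi\<^sub>E I Q) (prod_op I qop)"
      unfolding bi_orderable_def
    proof (intro exI[of _ "lex_prod_on W I Q r"] conjI ballI impI)
      show "lex_prod_on W I Q r \<subseteq> Pi\<^sub>E I Q \<times> Pi\<^sub>E I Q"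
        by (rule lex_prod_on_subset)
      show "strict_linear_order_on (Pi\<^sub>E I Q) (lex_prod_on W I Q r)"
        using W lin by (rule strict_linear_order_on_lex_prod_on)
    \<comment> \<open>The same lexicographic order has to respect right and left translations; the
      two remaining goals are these two compatibilities.\<close>
    qed (rule prod_op_left_mono_lex[OF assms left] prod_op_right_mono_lex[OF assms right];
        assumption)+
  }
qed

end
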